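(* Let $\mathcal{B}$ be a decorated bicategory with free globularly generated double category $Q_{\mathcal{B}}$. Let $C$ be a globularly generated double category such that $H^*C=\mathcal{B}$. Then there exists a unique strict double functor $\pi^C:Q_{\mathcal{B}}\to C$ such that the equation $H^*\pi^C\restriction_{\mathcal{B}}=id_{\mathcal{B}}$ holds, and such that $\pi^C$ is surjective on squares.
   Context: Double categories. A double category $C$ (possibly weak in the horizontal direction) consists of a category $C_0$ (objects and vertical morphisms), a category $C_1$ (horizontal morphisms and squares; composition in $C_1$ is vertical composition, written $\bullet$), functors $s,t:C_1\to C_0$ (left and right edge), a horizontal identity functor $i:C_0\to C_1$ (its value on a vertical morphism $f$ is the square $i_f$), a horizontal composition functor $*:C_1\times_{C_0}C_1\to C_1$ (the composite of $\Phi$ followed on its right by $\Psi$ is written $\Psi*\Phi$), and invertible globular associator and left/right unitor natural transformations satisfying the usual coherence axioms. A square is globular if its left and right edges are identity vertical morphisms. $HC$ denotes the horizontal bicategory of $C$: 0-cells, 1-cells, 2-cells are the objects, horizontal morphisms, globular squares of $C$. A strict double functor $F:C\to C'$ is a pair of functors $F_0:C_0\to C_0'$, $F_1:C_1\to C_1'$ strictly commuting with $s,t,i,*$ and preserving associators and unitors. Decorated bicategories. A decorated bicategory $\mathcal{B}$ is a bicategory (also written $\mathcal{B}$) together with a category $\mathcal{B}^*$ (the decoration) whose objects are the 0-cells of $\mathcal{B}$. For a double category $C$, $H^*C$ is the decorated bicategory given by the bicategory $HC$ decorated by $C_0$. $C$ is globularly generated if every square of $C$ can be obtained by vertical and horizontal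 compositions from globular squares and squares $i_f$, $f$ a vertical morphism. The free globularly generated double category $Q_{\mathcal{B}}$. Let $\mathbb{G}$ be the collection of formal squares of two kinds: for every 2-cell $\varphi:\alpha\Rightarrow\beta$ of $\mathcal{B}$ with $\alpha,\beta:a\to b$, a square $\varphi$ with top $\alpha$, bottom $\beta$, left edge $id_a$, right edge $id_b$; and for every morphism $f:a\to b$ of $\mathcal{B}^*$, a square $i_f$ with top the identity 1-cell $i_a$, bottom $i_b$, left and right edges $f$. The squares $i_{id_a}$ and $id_{i_a}$ are regarded as equal. Form all formal expressions obtained from $\mathbb{G}$ by formal vertical composition $\Psi\bullet\Phi$ (when the bottom of $\Phi$ equals the top of $\Psi$; left and right edges compose in $\mathcal{B}^*$) and formal parenthesized horizontal composition $\Psi*\Phi$ (when the right edge of $\Phi$ equals the left edge of $\Psi$; tops and bottoms compose as 1-cells of $\mathcal{B}$). Then $Q_{\mathcal{B}}$ has $\mathcal{B}^*$ as category of objects, the 1-cells of $\mathcal{B}$ (with their composition and identities) as horizontal morphisms, and as squares the expressions modulo the smallest equivalence relation compatible with $\bullet$ and $*$ such that: $\bullet$ is associative and the identity 2-cell $id_\alpha$ is a vertical identity at $\alpha$; (1) $(\Psi_2\bullet\Psi_1)*(\Phi_2\bullet\Phi_1)\sim(\Psi_2*\Phi_2)\bullet(\Psi_1*\Phi_1)$ whenever both sides make sense; (2) for vertically composable 2-cells of $\mathcal{B}$ the formal composite $\psi\bullet\varphi$ is identified with their vertical composite in $\mathcal{B}$, and $i_g\bullet i_f\sim i_{gf}$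 for composable $f,g$ in $\mathcal{B}^*$; (3) for horizontally composable 2-cells of $\mathcal{B}$ the formal composite $\psi*\varphi$ is identified with their horizontal composite in $\mathcal{B}$; (4) the left and right unitors of $\mathcal{B}$ are natural with respect to all squares; (5) the associators of $\mathcal{B}$ are natural with respect to all squares. Horizontal identities are the $i_f$; associators and unitors are those of $\mathcal{B}$. $Q_{\mathcal{B}}$ is globularly generated, and $\mathcal{B}$ is a sub-decorated bicategory of $H^*Q_{\mathcal{B}}$ (identity on $\mathcal{B}^*$ and 1-cells, each 2-cell sent to its class). The equation $H^*\pi^C\restriction_{\mathcal{B}}=id_{\mathcal{B}}$ means that $\pi^C$ acts as the identity on $\mathcal{B}^*$, on 1-cells of $\mathcal{B}$ and on (classes of) 2-cells of $\mathcal{B}$, the latter viewed in $C$ through $H^*C=\mathcal{B}$. *)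

theory Defs
  imports Main
begin

section \<open>Categories and functors\<close>

text \<open>
  All structures are carrier based: the value of an operation outside its carrier is
  irrelevant, and equality of two structures, or of two functors, means equality of the
  carriers together with agreement of all operations on them.
  Composites are written in applicative order: \<open>Comp K g f\<close> is \<open>f\<close> followed by \<open>g\<close>.
\<close>

record ('o, 'a) cat =
  Obj :: "'o set"
  Arr :: "'a set"
  Dom :: "'a \<Rightarrow> 'o"
  Cod :: "'a \<Rightarrow> 'o"
  Idt :: "'o \<Rightarrow> 'a"
  Comp :: "'a \<Rightarrow> 'a \<Rightarrow> 'a"

locale category =
  fixes K :: "('o, 'a) cat"
  assumes dom_obj: "f \<in> Arr K \<Longrightarrow> Dom K f \<in> Obj K"
    and cod_obj: "f \<in> Arr K \<Longrightarrow> Cod K f \<in> Obj K"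
    and id_arr: "a \<in> Obj K \<Longrightarrow> Idt K a \<in> Arr K"
    and dom_id: "a \<in> Obj K \<Longrightarrow> Dom K (Idt K a) = a"
    and cod_id: "a \<in> Obj K \<Longrightarrow> Cod K (Idt K a) = a"
    and comp_arr: "\<lbrakk>f \<in> Arr K; g \<in> Arr K; Cod K f = Dom K g\<rbrakk> \<Longrightarrow> Comp K g f \<in> Arr K"
    and dom_comp: "\<lbrakk>f \<in> Arr K; g \<in> Arr K; Cod K f = Dom K g\<rbrakk> \<Longrightarrow> Dom K (Comp K g f) = Dom K f"
    and cod_comp: "\<lbrakk>f \<in> Arr K; g \<in> Arr K; Cod K f = Dom K g\<rbrakk> \<Longrightarrow> Cod K (Comp K g f) = Cod K g"
    and id_left: "f \<in> Arr K \<Longrightarrow> Comp K (Idt K (Cod K f)) f = f"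
    and id_right: "f \<in> Arr K \<Longrightarrow> Comp K f (Idt K (Dom K f)) = f"
    and comp_assoc: "\<lbrakk>f \<in> Arr K; g \<in> Arr K; h \<in> Arr K; Cod K f = Dom K g; Cod K g = Dom K h\<rbrakk>
      \<Longrightarrow> Comp K (Comp K h g) f = Comp K h (Comp K g f)"

definition iso_in :: "('o, 'a) cat \<Rightarrow> 'a \<Rightarrow> bool" where
  "iso_in K f \<longleftrightarrow> f \<in> Arr K \<and>
     (\<exists>g \<in> Arr K. Dom K g = Cod K f \<and> Cod K g = Dom K f \<and>
        Comp K g f = Idt K (Dom K f) \<and> Comp K f g = Idt K (Cod K f))"

record ('o, 'a, 'p, 'b) fctr =
  fob :: "'o \<Rightarrow> 'p"
  far :: "'a \<Rightarrow> 'b"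

locale cat_functor = A: category A + B: category B
  for A :: "('o, 'a) cat" and B :: "('p, 'b) cat" +
  fixes F :: "('o, 'a, 'p, 'b) fctr"
  assumes fob_obj: "a \<in> Obj A \<Longrightarrow> fob F a \<in> Obj B"
    and far_arr: "f \<in> Arr A \<Longrightarrow> far F f \<in> Arr B"
    and far_dom: "f \<in> Arr A \<Longrightarrow> Dom B (far F f) = fob F (Dom A f)"
    and far_cod: "f \<in> Arr A \<Longrightarrow> Cod B (far F f) = fob F (Cod A f)"
    and far_id: "a \<in> Obj A \<Longrightarrow> far F (Idt A a) = Idt B (fob F a)"
    and far_comp: "\<lbrakk>f \<in> Arr A; g \<in> Arr A; Cod A f = Dom A g\<rbrakk>
      \<Longrightarrow> far F (Comp A g f) = Comp B (far F g) (far F f)"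

text \<open>
  The category of horizontally composable pairs \<open>(\<beta>, \<alpha>)\<close>, \<open>\<alpha>\<close> followed by \<open>\<beta>\<close>:
  \<open>so\<close>, \<open>to\<close> are the source and target maps on objects, \<open>sa\<close>, \<open>ta\<close> those on arrows.
\<close>

definition pairs_cat ::
  "('h, 's) cat \<Rightarrow> ('h \<Rightarrow> 'o) \<Rightarrow> ('h \<Rightarrow> 'o) \<Rightarrow> ('s \<Rightarrow> 'v) \<Rightarrow> ('s \<Rightarrow> 'v) \<Rightarrow> ('h \<times> 'h, 's \<times> 's) cat" where
  "pairs_cat K so to sa ta = \<lparr>
     Obj = {(\<beta>, \<alpha>). \<beta> \<in> Obj K \<and> \<alpha> \<in> Obj K \<and> so \<beta> = to \<alpha>},
     Arr = {(\<psi>, \<phi>). \<psi> \<in> Arr K \<and> \<phi> \<in> Arr K \<and> sa \<psi> = ta \<phi>},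
     Dom = (\<lambda>(\<psi>, \<phi>). (Dom K \<psi>, Dom K \<phi>)),
     Cod = (\<lambda>(\<psi>, \<phi>). (Cod K \<psi>, Cod K \<phi>)),
     Idt = (\<lambda>(\<beta>, \<alpha>). (Idt K \<beta>, Idt K \<alpha>)),
     Comp = (\<lambda>(\<psi>', \<phi>') (\<psi>, \<phi>). (Comp K \<psi>' \<psi>, Comp K \<phi>' \<phi>)) \<rparr>"

abbreviation hob :: "('h \<times> 'h, 's \<times> 's, 'h, 's) fctr \<Rightarrow> 'h \<Rightarrow> 'h \<Rightarrow> 'h" where
  "hob H \<beta> \<alpha> \<equiv> fob H (\<beta>, \<alpha>)"

abbreviation har :: "('h \<times> 'h, 's \<times> 's, 'h, 's) fctr \<Rightarrow> 's \<Rightarrow> 's \<Rightarrow> 's" where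
  "har H \<psi> \<phi> \<equiv> far H (\<psi>, \<phi>)"


section \<open>Decorated bicategories\<close>

text \<open>
  The field \<open>Hom\<close> is the disjoint union of all hom-categories: its objects are the 1-cells,
  its arrows the 2-cells, its composition the vertical composition of 2-cells.
\<close>

record ('o, 'h, 't) bicat =
  Zero :: "'o set"
  Hom :: "('h, 't) cat"
  bsrc :: "'h \<Rightarrow> 'o"
  btrg :: "'h \<Rightarrow> 'o"
  bunit :: "'o \<Rightarrow> 'h"
  bcomp :: "('h \<times> 'h, 't \<times> 't, 'h, 't) fctr"
  bassoc :: "'h \<Rightarrow> 'h \<Rightarrow> 'h \<Rightarrow> 't"
  blunit :: "'h \<Rightarrow> 't"
  brunit :: "'h \<Rightarrow> 't"

definition bpairs :: "('o, 'h, 't) bicat \<Rightarrow> ('h \<times> 'h, 't \<times> 't) cat" where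
  "bpairs B = pairs_cat (Hom B) (bsrc B) (btrg B)
     (\<lambda>\<phi>. bsrc B (Dom (Hom B) \<phi>)) (\<lambda>\<phi>. btrg B (Dom (Hom B) \<phi>))"

locale bicategory =
  hom: category "Hom B" + comp: cat_functor "bpairs B" "Hom B" "bcomp B"
  for B :: "('o, 'h, 't) bicat" +
  assumes src_zero: "\<alpha> \<in> Obj (Hom B) \<Longrightarrow> bsrc B \<alpha> \<in> Zero B"
    and trg_zero: "\<alpha> \<in> Obj (Hom B) \<Longrightarrow> btrg B \<alpha> \<in> Zero B"
    and src_parallel: "\<phi> \<in> Arr (Hom B) \<Longrightarrow> bsrc B (Cod (Hom B) \<phi>) = bsrc B (Dom (Hom B) \<phi>)"
    and trg_parallel: "\<phi> \<in> Arr (Hom B) \<Longrightarrow> btrg B (Cod (Hom B) \<phi>) = btrg B (Dom (Hom B) \<phi>)"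
    and unit_obj: "a \<in> Zero B \<Longrightarrow> bunit B a \<in> Obj (Hom B)"
    and src_unit: "a \<in> Zero B \<Longrightarrow> bsrc B (bunit B a) = a"
    and trg_unit: "a \<in> Zero B \<Longrightarrow> btrg B (bunit B a) = a"
    and src_comp: "(\<beta>, \<alpha>) \<in> Obj (bpairs B) \<Longrightarrow> bsrc B (hob (bcomp B) \<beta> \<alpha>) = bsrc B \<alpha>"
    and trg_comp: "(\<beta>, \<alpha>) \<in> Obj (bpairs B) \<Longrightarrow> btrg B (hob (bcomp B) \<beta> \<alpha>) = btrg B \<beta>"
    and assoc_iso: "\<lbrakk>(\<gamma>, \<beta>) \<in> Obj (bpairs B); (\<beta>, \<alpha>) \<in> Obj (bpairs B)\<rbrakk>
      \<Longrightarrow> iso_in (Hom B) (bassoc B \<gamma> \<beta> \<alpha>)"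
    and assoc_dom: "\<lbrakk>(\<gamma>, \<beta>) \<in> Obj (bpairs B); (\<beta>, \<alpha>) \<in> Obj (bpairs B)\<rbrakk>
      \<Longrightarrow> Dom (Hom B) (bassoc B \<gamma> \<beta> \<alpha>) = hob (bcomp B) (hob (bcomp B) \<gamma> \<beta>) \<alpha>"
    and assoc_cod: "\<lbrakk>(\<gamma>, \<beta>) \<in> Obj (bpairs B); (\<beta>, \<alpha>) \<in> Obj (bpairs B)\<rbrakk>
      \<Longrightarrow> Cod (Hom B) (bassoc B \<gamma> \<beta> \<alpha>) = hob (bcomp B) \<gamma> (hob (bcomp B) \<beta> \<alpha>)"
    and assoc_natural: "\<lbrakk>(\<chi>, \<psi>) \<in> Arr (bpairs B); (\<psi>, \<phi>) \<in> Arr (bpairs B)\<rbrakk>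
      \<Longrightarrow> Comp (Hom B)
            (bassoc B (Cod (Hom B) \<chi>) (Cod (Hom B) \<psi>) (Cod (Hom B) \<phi>))
            (har (bcomp B) (har (bcomp B) \<chi> \<psi>) \<phi>)
        = Comp (Hom B)
            (har (bcomp B) \<chi> (har (bcomp B) \<psi> \<phi>))
            (bassoc B (Dom (Hom B) \<chi>) (Dom (Hom B) \<psi>) (Dom (Hom B) \<phi>))"
    and lunit_iso: "\<alpha> \<in> Obj (Hom B) \<Longrightarrow> iso_in (Hom B) (blunit B \<alpha>)"
    and lunit_dom: "\<alpha> \<in> Obj (Hom B)
      \<Longrightarrow> Dom (Hom B) (blunit B \<alpha>) = hob (bcomp B) (bunit B (btrg B \<alpha>)) \<alpha>"
    and lunit_cod: "\<alpha> \<in> Obj (Hom B) \<Longrightarrow> Cod (Hom B) (blunit B \<alpha>) = \<alpha>"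
    and lunit_natural: "\<phi> \<in> Arr (Hom B)
      \<Longrightarrow> Comp (Hom B) (blunit B (Cod (Hom B) \<phi>))
            (har (bcomp B) (Idt (Hom B) (bunit B (btrg B (Dom (Hom B) \<phi>)))) \<phi>)
        = Comp (Hom B) \<phi> (blunit B (Dom (Hom B) \<phi>))"
    and runit_iso: "\<alpha> \<in> Obj (Hom B) \<Longrightarrow> iso_in (Hom B) (brunit B \<alpha>)"
    and runit_dom: "\<alpha> \<in> Obj (Hom B)
      \<Longrightarrow> Dom (Hom B) (brunit B \<alpha>) = hob (bcomp B) \<alpha> (bunit B (bsrc B \<alpha>))"
    and runit_cod: "\<alpha> \<in> Obj (Hom B) \<Longrightarrow> Cod (Hom B) (brunit B \<alpha>) = \<alpha>"
    and runit_natural: "\<phi> \<in> Arr (Hom B)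
      \<Longrightarrow> Comp (Hom B) (brunit B (Cod (Hom B) \<phi>))
            (har (bcomp B) \<phi> (Idt (Hom B) (bunit B (bsrc B (Dom (Hom B) \<phi>)))))
        = Comp (Hom B) \<phi> (brunit B (Dom (Hom B) \<phi>))"
    and pentagon: "\<lbrakk>(\<delta>, \<gamma>) \<in> Obj (bpairs B); (\<gamma>, \<beta>) \<in> Obj (bpairs B); (\<beta>, \<alpha>) \<in> Obj (bpairs B)\<rbrakk>
      \<Longrightarrow> Comp (Hom B) (bassoc B \<delta> \<gamma> (hob (bcomp B) \<beta> \<alpha>)) (bassoc B (hob (bcomp B) \<delta> \<gamma>) \<beta> \<alpha>)
        = Comp (Hom B) (har (bcomp B) (Idt (Hom B) \<delta>) (bassoc B \<gamma> \<beta> \<alpha>))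
            (Comp (Hom B) (bassoc B \<delta> (hob (bcomp B) \<gamma> \<beta>) \<alpha>)
              (har (bcomp B) (bassoc B \<delta> \<gamma> \<beta>) (Idt (Hom B) \<alpha>)))"
    and triangle: "(\<beta>, \<alpha>) \<in> Obj (bpairs B)
      \<Longrightarrow> Comp (Hom B) (har (bcomp B) (Idt (Hom B) \<beta>) (blunit B \<alpha>))
            (bassoc B \<beta> (bunit B (bsrc B \<beta>)) \<alpha>)
        = har (bcomp B) (brunit B \<beta>) (Idt (Hom B) \<alpha>)"

record ('o, 'v, 'h, 't) dec_bicat =
  Bic :: "('o, 'h, 't) bicat"
  Deco :: "('o, 'v) cat"

locale decorated_bicategory =
  bic: bicategory "Bic B" + deco: category "Deco B"
  for B :: "('o, 'v, 'h, 't) dec_bicat" +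
  assumes deco_obj: "Obj (Deco B) = Zero (Bic B)"

definition cat_eq :: "('o, 'a) cat \<Rightarrow> ('o, 'a) cat \<Rightarrow> bool" where
  "cat_eq K L \<longleftrightarrow>
     Obj K = Obj L \<and> Arr K = Arr L \<and>
     (\<forall>f \<in> Arr K. Dom K f = Dom L f \<and> Cod K f = Cod L f) \<and>
     (\<forall>a \<in> Obj K. Idt K a = Idt L a) \<and>
     (\<forall>f \<in> Arr K. \<forall>g \<in> Arr K. Cod K f = Dom K g \<longrightarrow> Comp K g f = Comp L g f)"

definition functor_eq ::
  "('o, 'a) cat \<Rightarrow> ('o, 'a, 'p, 'b) fctr \<Rightarrow> ('o, 'a, 'p, 'b) fctr \<Rightarrow> bool" where
  "functor_eq A F G \<longleftrightarrow>
     (\<forall>a \<in> Obj A. fob F a = fob G a) \<and> (\<forall>f \<in> Arr A. far F f = far G f)"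

definition bicat_eq :: "('o, 'h, 't) bicat \<Rightarrow> ('o, 'h, 't) bicat \<Rightarrow> bool" where
  "bicat_eq B B' \<longleftrightarrow>
     Zero B = Zero B' \<and> cat_eq (Hom B) (Hom B') \<and>
     (\<forall>\<alpha> \<in> Obj (Hom B). bsrc B \<alpha> = bsrc B' \<alpha> \<and> btrg B \<alpha> = btrg B' \<alpha>) \<and>
     (\<forall>a \<in> Zero B. bunit B a = bunit B' a) \<and>
     functor_eq (bpairs B) (bcomp B) (bcomp B') \<and>
     (\<forall>\<gamma> \<beta> \<alpha>. (\<gamma>, \<beta>) \<in> Obj (bpairs B) \<and> (\<beta>, \<alpha>) \<in> Obj (bpairs B) \<longrightarrow>
        bassoc B \<gamma> \<beta> \<alpha> = bassoc B' \<gamma> \<beta> \<alpha>) \<and>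
     (\<forall>\<alpha> \<in> Obj (Hom B). blunit B \<alpha> = blunit B' \<alpha> \<and> brunit B \<alpha> = brunit B' \<alpha>)"

definition dec_bicat_eq ::
  "('o, 'v, 'h, 't) dec_bicat \<Rightarrow> ('o, 'v, 'h, 't) dec_bicat \<Rightarrow> bool" where
  "dec_bicat_eq B B' \<longleftrightarrow> bicat_eq (Bic B) (Bic B') \<and> cat_eq (Deco B) (Deco B')"


section \<open>Double categories\<close>

text \<open>
  In \<open>C1\<close>, the domain of a square is its top, the codomain its bottom; \<open>sfun\<close> and \<open>tfun\<close>
  give its left and right edge.
\<close>

record ('o, 'v, 'h, 's) dblcat =
  C0 :: "('o, 'v) cat"
  C1 :: "('h, 's) cat"
  sfun :: "('h, 's, 'o, 'v) fctr"
  tfun :: "('h, 's, 'o, 'v) fctr"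
  ifun :: "('o, 'v, 'h, 's) fctr"
  hcomp :: "('h \<times> 'h, 's \<times> 's, 'h, 's) fctr"
  assoc :: "'h \<Rightarrow> 'h \<Rightarrow> 'h \<Rightarrow> 's"
  lunit :: "'h \<Rightarrow> 's"
  runit :: "'h \<Rightarrow> 's"

definition hpairs :: "('o, 'v, 'h, 's) dblcat \<Rightarrow> ('h \<times> 'h, 's \<times> 's) cat" where
  "hpairs C = pairs_cat (C1 C) (fob (sfun C)) (fob (tfun C)) (far (sfun C)) (far (tfun C))"

definition globular :: "('o, 'v, 'h, 's) dblcat \<Rightarrow> 's \<Rightarrow> bool" where
  "globular C \<Phi> \<longleftrightarrow> \<Phi> \<in> Arr (C1 C) \<and>
     (\<exists>a \<in> Obj (C0 C). far (sfun C) \<Phi> = Idt (C0 C) a) \<and>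
     (\<exists>b \<in> Obj (C0 C). far (tfun C) \<Phi> = Idt (C0 C) b)"

locale double_category =
  C0: category "C0 C" + C1: category "C1 C" +
  s: cat_functor "C1 C" "C0 C" "sfun C" +
  t: cat_functor "C1 C" "C0 C" "tfun C" +
  i: cat_functor "C0 C" "C1 C" "ifun C" +
  hcomp: cat_functor "hpairs C" "C1 C" "hcomp C"
  for C :: "('o, 'v, 'h, 's) dblcat" +
  assumes s_i_obj: "a \<in> Obj (C0 C) \<Longrightarrow> fob (sfun C) (fob (ifun C) a) = a"
    and t_i_obj: "a \<in> Obj (C0 C) \<Longrightarrow> fob (tfun C) (fob (ifun C) a) = a"
    and s_i_arr: "f \<in> Arr (C0 C) \<Longrightarrow> far (sfun C) (far (ifun C) f) = f"
    and t_i_arr: "f \<in> Arr (C0 C) \<Longrightarrow> far (tfun C) (far (ifun C) f) = f"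
    and s_comp_obj: "(\<beta>, \<alpha>) \<in> Obj (hpairs C)
      \<Longrightarrow> fob (sfun C) (hob (hcomp C) \<beta> \<alpha>) = fob (sfun C) \<alpha>"
    and t_comp_obj: "(\<beta>, \<alpha>) \<in> Obj (hpairs C)
      \<Longrightarrow> fob (tfun C) (hob (hcomp C) \<beta> \<alpha>) = fob (tfun C) \<beta>"
    and s_comp_arr: "(\<Psi>, \<Phi>) \<in> Arr (hpairs C)
      \<Longrightarrow> far (sfun C) (har (hcomp C) \<Psi> \<Phi>) = far (sfun C) \<Phi>"
    and t_comp_arr: "(\<Psi>, \<Phi>) \<in> Arr (hpairs C)
      \<Longrightarrow> far (tfun C) (har (hcomp C) \<Psi> \<Phi>) = far (tfun C) \<Psi>"
    and assoc_glob: "\<lbrakk>(\<gamma>, \<beta>) \<in> Obj (hpairs C); (\<beta>, \<alpha>) \<in> Obj (hpairs C)\<rbrakk>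
      \<Longrightarrow> globular C (assoc C \<gamma> \<beta> \<alpha>)"
    and assoc_iso: "\<lbrakk>(\<gamma>, \<beta>) \<in> Obj (hpairs C); (\<beta>, \<alpha>) \<in> Obj (hpairs C)\<rbrakk>
      \<Longrightarrow> iso_in (C1 C) (assoc C \<gamma> \<beta> \<alpha>)"
    and assoc_dom: "\<lbrakk>(\<gamma>, \<beta>) \<in> Obj (hpairs C); (\<beta>, \<alpha>) \<in> Obj (hpairs C)\<rbrakk>
      \<Longrightarrow> Dom (C1 C) (assoc C \<gamma> \<beta> \<alpha>) = hob (hcomp C) (hob (hcomp C) \<gamma> \<beta>) \<alpha>"
    and assoc_cod: "\<lbrakk>(\<gamma>, \<beta>) \<in> Obj (hpairs C); (\<beta>, \<alpha>) \<in> Obj (hpairs C)\<rbrakk>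
      \<Longrightarrow> Cod (C1 C) (assoc C \<gamma> \<beta> \<alpha>) = hob (hcomp C) \<gamma> (hob (hcomp C) \<beta> \<alpha>)"
    and assoc_natural: "\<lbrakk>(\<Theta>, \<Psi>) \<in> Arr (hpairs C); (\<Psi>, \<Phi>) \<in> Arr (hpairs C)\<rbrakk>
      \<Longrightarrow> Comp (C1 C)
            (assoc C (Cod (C1 C) \<Theta>) (Cod (C1 C) \<Psi>) (Cod (C1 C) \<Phi>))
            (har (hcomp C) (har (hcomp C) \<Theta> \<Psi>) \<Phi>)
        = Comp (C1 C)
            (har (hcomp C) \<Theta> (har (hcomp C) \<Psi> \<Phi>))
            (assoc C (Dom (C1 C) \<Theta>) (Dom (C1 C) \<Psi>) (Dom (C1 C) \<Phi>))"
    and lunit_glob: "\<alpha> \<in> Obj (C1 C) \<Longrightarrow> globular C (lunit C \<alpha>)"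
    and lunit_iso: "\<alpha> \<in> Obj (C1 C) \<Longrightarrow> iso_in (C1 C) (lunit C \<alpha>)"
    and lunit_dom: "\<alpha> \<in> Obj (C1 C)
      \<Longrightarrow> Dom (C1 C) (lunit C \<alpha>) = hob (hcomp C) (fob (ifun C) (fob (tfun C) \<alpha>)) \<alpha>"
    and lunit_cod: "\<alpha> \<in> Obj (C1 C) \<Longrightarrow> Cod (C1 C) (lunit C \<alpha>) = \<alpha>"
    and lunit_natural: "\<Phi> \<in> Arr (C1 C)
      \<Longrightarrow> Comp (C1 C) (lunit C (Cod (C1 C) \<Phi>))
            (har (hcomp C) (far (ifun C) (far (tfun C) \<Phi>)) \<Phi>)
        = Comp (C1 C) \<Phi> (lunit C (Dom (C1 C) \<Phi>))"
    and runit_glob: "\<alpha> \<in> Obj (C1 C) \<Longrightarrow> globular C (runit C \<alpha>)"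
    and runit_iso: "\<alpha> \<in> Obj (C1 C) \<Longrightarrow> iso_in (C1 C) (runit C \<alpha>)"
    and runit_dom: "\<alpha> \<in> Obj (C1 C)
      \<Longrightarrow> Dom (C1 C) (runit C \<alpha>) = hob (hcomp C) \<alpha> (fob (ifun C) (fob (sfun C) \<alpha>))"
    and runit_cod: "\<alpha> \<in> Obj (C1 C) \<Longrightarrow> Cod (C1 C) (runit C \<alpha>) = \<alpha>"
    and runit_natural: "\<Phi> \<in> Arr (C1 C)
      \<Longrightarrow> Comp (C1 C) (runit C (Cod (C1 C) \<Phi>))
            (har (hcomp C) \<Phi> (far (ifun C) (far (sfun C) \<Phi>)))
        = Comp (C1 C) \<Phi> (runit C (Dom (C1 C) \<Phi>))"
    and pentagon: "\<lbrakk>(\<delta>, \<gamma>) \<in> Obj (hpairs C); (\<gamma>, \<beta>) \<in> Obj (hpairs C); (\<beta>, \<alpha>) \<in> Obj (hpairs C)\<rbrakk>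
      \<Longrightarrow> Comp (C1 C) (assoc C \<delta> \<gamma> (hob (hcomp C) \<beta> \<alpha>)) (assoc C (hob (hcomp C) \<delta> \<gamma>) \<beta> \<alpha>)
        = Comp (C1 C) (har (hcomp C) (Idt (C1 C) \<delta>) (assoc C \<gamma> \<beta> \<alpha>))
            (Comp (C1 C) (assoc C \<delta> (hob (hcomp C) \<gamma> \<beta>) \<alpha>)
              (har (hcomp C) (assoc C \<delta> \<gamma> \<beta>) (Idt (C1 C) \<alpha>)))"
    and triangle: "(\<beta>, \<alpha>) \<in> Obj (hpairs C)
      \<Longrightarrow> Comp (C1 C) (har (hcomp C) (Idt (C1 C) \<beta>) (lunit C \<alpha>))
            (assoc C \<beta> (fob (ifun C) (fob (sfun C) \<beta>)) \<alpha>)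
        = har (hcomp C) (runit C \<beta>) (Idt (C1 C) \<alpha>)"

definition horizontal_bicat :: "('o, 'v, 'h, 's) dblcat \<Rightarrow> ('o, 'h, 's) bicat" where
  "horizontal_bicat C = \<lparr>
     Zero = Obj (C0 C),
     Hom = \<lparr> Obj = Obj (C1 C), Arr = {\<Phi>. globular C \<Phi>}, Dom = Dom (C1 C), Cod = Cod (C1 C),
             Idt = Idt (C1 C), Comp = Comp (C1 C) \<rparr>,
     bsrc = fob (sfun C), btrg = fob (tfun C),
     bunit = fob (ifun C), bcomp = hcomp C,
     bassoc = assoc C, blunit = lunit C, brunit = runit C \<rparr>"

definition Hstar :: "('o, 'v, 'h, 's) dblcat \<Rightarrow> ('o, 'v, 'h, 's) dec_bicat" where
  "Hstar C = \<lparr> Bic = horizontal_bicat C, Deco = C0 C \<rparr>"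

inductive_set glob_gen_squares :: "('o, 'v, 'h, 's) dblcat \<Rightarrow> 's set"
  for C :: "('o, 'v, 'h, 's) dblcat" where
  globular: "globular C \<Phi> \<Longrightarrow> \<Phi> \<in> glob_gen_squares C"
| hor_id: "f \<in> Arr (C0 C) \<Longrightarrow> far (ifun C) f \<in> glob_gen_squares C"
| vcomp: "\<lbrakk>\<Phi> \<in> glob_gen_squares C; \<Psi> \<in> glob_gen_squares C; Cod (C1 C) \<Phi> = Dom (C1 C) \<Psi>\<rbrakk>
    \<Longrightarrow> Comp (C1 C) \<Psi> \<Phi> \<in> glob_gen_squares C"
| hcomp: "\<lbrakk>\<Phi> \<in> glob_gen_squares C; \<Psi> \<in> glob_gen_squares C; far (tfun C) \<Phi> = far (sfun C) \<Psi>\<rbrakk>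
    \<Longrightarrow> har (hcomp C) \<Psi> \<Phi> \<in> glob_gen_squares C"

definition globularly_generated :: "('o, 'v, 'h, 's) dblcat \<Rightarrow> bool" where
  "globularly_generated C \<longleftrightarrow> Arr (C1 C) \<subseteq> glob_gen_squares C"

type_synonym ('o, 'v, 'h, 's, 'p, 'w, 'k, 'r) dblfun =
  "('o, 'v, 'p, 'w) fctr \<times> ('h, 's, 'k, 'r) fctr"

locale strict_double_functor =
  C: double_category C + D: double_category D +
  F0: cat_functor "C0 C" "C0 D" "fst F" +
  F1: cat_functor "C1 C" "C1 D" "snd F"
  for C :: "('o, 'v, 'h, 's) dblcat" and D :: "('p, 'w, 'k, 'r) dblcat"
    and F :: "('o, 'v, 'h, 's, 'p, 'w, 'k, 'r) dblfun" +
  assumes pres_s_obj: "\<alpha> \<in> Obj (C1 C)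
      \<Longrightarrow> fob (sfun D) (fob (snd F) \<alpha>) = fob (fst F) (fob (sfun C) \<alpha>)"
    and pres_s_arr: "\<Phi> \<in> Arr (C1 C)
      \<Longrightarrow> far (sfun D) (far (snd F) \<Phi>) = far (fst F) (far (sfun C) \<Phi>)"
    and pres_t_obj: "\<alpha> \<in> Obj (C1 C)
      \<Longrightarrow> fob (tfun D) (fob (snd F) \<alpha>) = fob (fst F) (fob (tfun C) \<alpha>)"
    and pres_t_arr: "\<Phi> \<in> Arr (C1 C)
      \<Longrightarrow> far (tfun D) (far (snd F) \<Phi>) = far (fst F) (far (tfun C) \<Phi>)"
    and pres_i_obj: "a \<in> Obj (C0 C)
      \<Longrightarrow> fob (snd F) (fob (ifun C) a) = fob (ifun D) (fob (fst F) a)"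
    and pres_i_arr: "f \<in> Arr (C0 C)
      \<Longrightarrow> far (snd F) (far (ifun C) f) = far (ifun D) (far (fst F) f)"
    and pres_comp_obj: "(\<beta>, \<alpha>) \<in> Obj (hpairs C)
      \<Longrightarrow> fob (snd F) (hob (hcomp C) \<beta> \<alpha>) = hob (hcomp D) (fob (snd F) \<beta>) (fob (snd F) \<alpha>)"
    and pres_comp_arr: "(\<Psi>, \<Phi>) \<in> Arr (hpairs C)
      \<Longrightarrow> far (snd F) (har (hcomp C) \<Psi> \<Phi>) = har (hcomp D) (far (snd F) \<Psi>) (far (snd F) \<Phi>)"
    and pres_assoc: "\<lbrakk>(\<gamma>, \<beta>) \<in> Obj (hpairs C); (\<beta>, \<alpha>) \<in> Obj (hpairs C)\<rbrakk>
      \<Longrightarrow> far (snd F) (assoc C \<gamma> \<beta> \<alpha>)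
        = assoc D (fob (snd F) \<gamma>) (fob (snd F) \<beta>) (fob (snd F) \<alpha>)"
    and pres_lunit: "\<alpha> \<in> Obj (C1 C) \<Longrightarrow> far (snd F) (lunit C \<alpha>) = lunit D (fob (snd F) \<alpha>)"
    and pres_runit: "\<alpha> \<in> Obj (C1 C) \<Longrightarrow> far (snd F) (runit C \<alpha>) = runit D (fob (snd F) \<alpha>)"

definition double_functor_eq ::
  "('o, 'v, 'h, 's) dblcat \<Rightarrow> ('o, 'v, 'h, 's, 'p, 'w, 'k, 'r) dblfun \<Rightarrow>
   ('o, 'v, 'h, 's, 'p, 'w, 'k, 'r) dblfun \<Rightarrow> bool" where
  "double_functor_eq C F G \<longleftrightarrow>
     functor_eq (C0 C) (fst F) (fst G) \<and> functor_eq (C1 C) (snd F) (snd G)"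

definition surjective_on_squares ::
  "('o, 'v, 'h, 's) dblcat \<Rightarrow> ('p, 'w, 'k, 'r) dblcat \<Rightarrow>
   ('o, 'v, 'h, 's, 'p, 'w, 'k, 'r) dblfun \<Rightarrow> bool" where
  "surjective_on_squares C D F \<longleftrightarrow> far (snd F) ` Arr (C1 C) = Arr (C1 D)"


section \<open>The free globularly generated double category\<close>

text \<open>
  Raw expressions; \<open>formal_square\<close> below singles out those in which all composites are formed
  along matching boundaries. \<open>FV \<Psi> \<Phi>\<close> is \<open>\<Phi>\<close> with \<open>\<Psi>\<close> below, \<open>FH \<Psi> \<Phi>\<close> is \<open>\<Phi>\<close> with \<open>\<Psi>\<close>
  on its right.
\<close>

datatype ('v, 't) fexp =
    FCell 't
  | FId 'v
  | FV "('v, 't) fexp" "('v, 't) fexp"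
  | FH "('v, 't) fexp" "('v, 't) fexp"

context
  fixes B :: "('o, 'v, 'h, 't) dec_bicat"
begin

primrec ftop :: "('v, 't) fexp \<Rightarrow> 'h" where
  "ftop (FCell \<phi>) = Dom (Hom (Bic B)) \<phi>"
| "ftop (FId f) = bunit (Bic B) (Dom (Deco B) f)"
| "ftop (FV \<Psi> \<Phi>) = ftop \<Phi>"
| "ftop (FH \<Psi> \<Phi>) = hob (bcomp (Bic B)) (ftop \<Psi>) (ftop \<Phi>)"

primrec fbot :: "('v, 't) fexp \<Rightarrow> 'h" where
  "fbot (FCell \<phi>) = Cod (Hom (Bic B)) \<phi>"
| "fbot (FId f) = bunit (Bic B) (Cod (Deco B) f)"
| "fbot (FV \<Psi> \<Phi>) = fbot \<Psi>"
| "fbot (FH \<Psi> \<Phi>) = hob (bcomp (Bic B)) (fbot \<Psi>) (fbot \<Phi>)"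

primrec fleft :: "('v, 't) fexp \<Rightarrow> 'v" where
  "fleft (FCell \<phi>) = Idt (Deco B) (bsrc (Bic B) (Dom (Hom (Bic B)) \<phi>))"
| "fleft (FId f) = f"
| "fleft (FV \<Psi> \<Phi>) = Comp (Deco B) (fleft \<Psi>) (fleft \<Phi>)"
| "fleft (FH \<Psi> \<Phi>) = fleft \<Phi>"

primrec fright :: "('v, 't) fexp \<Rightarrow> 'v" where
  "fright (FCell \<phi>) = Idt (Deco B) (btrg (Bic B) (Dom (Hom (Bic B)) \<phi>))"
| "fright (FId f) = f"
| "fright (FV \<Psi> \<Phi>) = Comp (Deco B) (fright \<Psi>) (fright \<Phi>)"
| "fright (FH \<Psi> \<Phi>) = fright \<Psi>"

primrec formal_square :: "('v, 't) fexp \<Rightarrow> bool" where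
  "formal_square (FCell \<phi>) \<longleftrightarrow> \<phi> \<in> Arr (Hom (Bic B))"
| "formal_square (FId f) \<longleftrightarrow> f \<in> Arr (Deco B)"
| "formal_square (FV \<Psi> \<Phi>) \<longleftrightarrow> formal_square \<Psi> \<and> formal_square \<Phi> \<and> fbot \<Phi> = ftop \<Psi>"
| "formal_square (FH \<Psi> \<Phi>) \<longleftrightarrow> formal_square \<Psi> \<and> formal_square \<Phi> \<and> fright \<Phi> = fleft \<Psi>"

inductive fequiv :: "('v, 't) fexp \<Rightarrow> ('v, 't) fexp \<Rightarrow> bool" where
  refl: "formal_square \<Phi> \<Longrightarrow> fequiv \<Phi> \<Phi>"
| sym: "fequiv \<Phi> \<Psi> \<Longrightarrow> fequiv \<Psi> \<Phi>"
| trans: "\<lbrakk>fequiv \<Phi> \<Psi>; fequiv \<Psi> \<Theta>\<rbrakk> \<Longrightarrow> fequiv \<Phi> \<Theta>"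
| cong_v: "\<lbrakk>fequiv \<Psi> \<Psi>'; fequiv \<Phi> \<Phi>'; formal_square (FV \<Psi> \<Phi>); formal_square (FV \<Psi>' \<Phi>')\<rbrakk>
    \<Longrightarrow> fequiv (FV \<Psi> \<Phi>) (FV \<Psi>' \<Phi>')"
| cong_h: "\<lbrakk>fequiv \<Psi> \<Psi>'; fequiv \<Phi> \<Phi>'; formal_square (FH \<Psi> \<Phi>); formal_square (FH \<Psi>' \<Phi>')\<rbrakk>
    \<Longrightarrow> fequiv (FH \<Psi> \<Phi>) (FH \<Psi>' \<Phi>')"
| hor_id_id: "a \<in> Obj (Deco B)
    \<Longrightarrow> fequiv (FId (Idt (Deco B) a)) (FCell (Idt (Hom (Bic B)) (bunit (Bic B) a)))"
| v_assoc: "formal_square (FV (FV \<Theta> \<Psi>) \<Phi>) \<Longrightarrow> fequiv (FV (FV \<Theta> \<Psi>) \<Phi>) (FV \<Theta> (FV \<Psi> \<Phi>))"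
| v_id_left: "formal_square \<Phi> \<Longrightarrow> fequiv (FV (FCell (Idt (Hom (Bic B)) (fbot \<Phi>))) \<Phi>) \<Phi>"
| v_id_right: "formal_square \<Phi> \<Longrightarrow> fequiv (FV \<Phi> (FCell (Idt (Hom (Bic B)) (ftop \<Phi>)))) \<Phi>"
| interchange:
    "\<lbrakk>formal_square (FH (FV \<Psi>2 \<Psi>1) (FV \<Phi>2 \<Phi>1)); formal_square (FV (FH \<Psi>2 \<Phi>2) (FH \<Psi>1 \<Phi>1))\<rbrakk>
    \<Longrightarrow> fequiv (FH (FV \<Psi>2 \<Psi>1) (FV \<Phi>2 \<Phi>1)) (FV (FH \<Psi>2 \<Phi>2) (FH \<Psi>1 \<Phi>1))"
| v_cell: "formal_square (FV (FCell \<psi>) (FCell \<phi>))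
    \<Longrightarrow> fequiv (FV (FCell \<psi>) (FCell \<phi>)) (FCell (Comp (Hom (Bic B)) \<psi> \<phi>))"
| v_hor_id: "\<lbrakk>f \<in> Arr (Deco B); g \<in> Arr (Deco B); Cod (Deco B) f = Dom (Deco B) g\<rbrakk>
    \<Longrightarrow> fequiv (FV (FId g) (FId f)) (FId (Comp (Deco B) g f))"
| h_cell: "(\<psi>, \<phi>) \<in> Arr (bpairs (Bic B))
    \<Longrightarrow> fequiv (FH (FCell \<psi>) (FCell \<phi>)) (FCell (har (bcomp (Bic B)) \<psi> \<phi>))"
| lunit_nat: "formal_square \<Phi>
    \<Longrightarrow> fequiv (FV (FCell (blunit (Bic B) (fbot \<Phi>))) (FH (FId (fright \<Phi>)) \<Phi>))
               (FV \<Phi> (FCell (blunit (Bic B) (ftop \<Phi>))))"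
| runit_nat: "formal_square \<Phi>
    \<Longrightarrow> fequiv (FV (FCell (brunit (Bic B) (fbot \<Phi>))) (FH \<Phi> (FId (fleft \<Phi>))))
               (FV \<Phi> (FCell (brunit (Bic B) (ftop \<Phi>))))"
| assoc_nat: "\<lbrakk>formal_square (FH \<Theta> \<Psi>); formal_square (FH \<Psi> \<Phi>)\<rbrakk>
    \<Longrightarrow> fequiv (FV (FCell (bassoc (Bic B) (fbot \<Theta>) (fbot \<Psi>) (fbot \<Phi>))) (FH (FH \<Theta> \<Psi>) \<Phi>))
               (FV (FH \<Theta> (FH \<Psi> \<Phi>)) (FCell (bassoc (Bic B) (ftop \<Theta>) (ftop \<Psi>) (ftop \<Phi>))))"

definition frel :: "(('v, 't) fexp \<times> ('v, 't) fexp) set" where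
  "frel = {(\<Phi>, \<Psi>). fequiv \<Phi> \<Psi>}"

definition fclass :: "('v, 't) fexp \<Rightarrow> ('v, 't) fexp set" where
  "fclass \<Phi> = frel `` {\<Phi>}"

text \<open>
  Equivalent expressions have equal boundaries, so the singletons taken apart by \<open>the_elem\<close>
  and the unions over all representatives below are the operations induced on classes.
\<close>

definition freeQ :: "('o, 'v, 'h, ('v, 't) fexp set) dblcat" where
  "freeQ = \<lparr>
     C0 = Deco B,
     C1 = \<lparr> Obj = Obj (Hom (Bic B)),
            Arr = {\<Phi>. formal_square \<Phi>} // frel,
            Dom = (\<lambda>X. the_elem (ftop ` X)),
            Cod = (\<lambda>X. the_elem (fbot ` X)),
            Idt = (\<lambda>\<alpha>. fclass (FCell (Idt (Hom (Bic B)) \<alpha>))),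
            Comp = (\<lambda>Y X. \<Union>\<Psi> \<in> Y. \<Union>\<Phi> \<in> X. fclass (FV \<Psi> \<Phi>)) \<rparr>,
     sfun = \<lparr> fob = bsrc (Bic B), far = (\<lambda>X. the_elem (fleft ` X)) \<rparr>,
     tfun = \<lparr> fob = btrg (Bic B), far = (\<lambda>X. the_elem (fright ` X)) \<rparr>,
     ifun = \<lparr> fob = bunit (Bic B), far = (\<lambda>f. fclass (FId f)) \<rparr>,
     hcomp = \<lparr> fob = fob (bcomp (Bic B)),
               far = (\<lambda>(Y, X). \<Union>\<Psi> \<in> Y. \<Union>\<Phi> \<in> X. fclass (FH \<Psi> \<Phi>)) \<rparr>,
     assoc = (\<lambda>\<gamma> \<beta> \<alpha>. fclass (FCell (bassoc (Bic B) \<gamma> \<beta> \<alpha>))),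
     lunit = (\<lambda>\<alpha>. fclass (FCell (blunit (Bic B) \<alpha>))),
     runit = (\<lambda>\<alpha>. fclass (FCell (brunit (Bic B) \<alpha>))) \<rparr>"

end

text \<open>
  For \<open>F\<close> from \<open>freeQ B\<close> to a double category \<open>C\<close> with \<open>H\<^sup>*C = B\<close>, the equation
  \<open>H\<^sup>*F\<restriction>B = id\<close>, where a 2-cell of \<open>B\<close> is viewed in \<open>freeQ B\<close> as its class.
\<close>

definition restricts_to_identity ::
  "('o, 'v, 'h, 't) dec_bicat \<Rightarrow>
   ('o, 'v, 'h, ('v, 't) fexp set, 'o, 'v, 'h, 't) dblfun \<Rightarrow> bool" where
  "restricts_to_identity B F \<longleftrightarrow>
     (\<forall>a \<in> Obj (Deco B). fob (fst F) a = a) \<and>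
     (\<forall>f \<in> Arr (Deco B). far (fst F) f = f) \<and>
     (\<forall>\<alpha> \<in> Obj (Hom (Bic B)). fob (snd F) \<alpha> = \<alpha>) \<and>
     (\<forall>\<phi> \<in> Arr (Hom (Bic B)). far (snd F) (fclass B (FCell \<phi>)) = \<phi>)"

end

theory Submission
  imports Defs
begin

text \<open>
  Since \<open>H\<^sup>*C = B\<close>, every formal square has a value in \<open>C\<close>: interpret 2-cells as the globular
  squares they are, \<open>i\<^sub>f\<close> as the horizontal identity square of \<open>f\<close>, and formal composites as composites.
  Each generating relation of \<open>fequiv\<close> is an axiom of the double category \<open>C\<close> or an instance of
  \<open>H\<^sup>*C = B\<close>, so values descend to classes and give \<open>\<pi>\<close>. A strict double functor that is the
  identity on \<open>B\<close> is forced on generators and hence on all formal squares. Values are closed under both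
  compositions and contain the generators of \<open>C\<close>, whence surjectivity.
\<close>

section \<open>Categories of composable pairs\<close>

lemma pairs_cat_simps [simp]:
  "(\<beta>, \<alpha>) \<in> Obj (pairs_cat K so to sa ta) \<longleftrightarrow> \<beta> \<in> Obj K \<and> \<alpha> \<in> Obj K \<and> so \<beta> = to \<alpha>"
  "(\<psi>, \<phi>) \<in> Arr (pairs_cat K so to sa ta) \<longleftrightarrow> \<psi> \<in> Arr K \<and> \<phi> \<in> Arr K \<and> sa \<psi> = ta \<phi>"
  "Dom (pairs_cat K so to sa ta) (\<psi>, \<phi>) = (Dom K \<psi>, Dom K \<phi>)"
  "Cod (pairs_cat K so to sa ta) (\<psi>, \<phi>) = (Cod K \<psi>, Cod K \<phi>)"
  "Idt (pairs_cat K so to sa ta) (\<beta>, \<alpha>) = (Idt K \<beta>, Idt K \<alpha>)"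
  "Comp (pairs_cat K so to sa ta) (\<psi>', \<phi>') (\<psi>, \<phi>) = (Comp K \<psi>' \<psi>, Comp K \<phi>' \<phi>)"
  by (auto simp: pairs_cat_def)

text \<open>The matching condition on arrows survives composites and identities because
  \<open>S\<close> and \<open>T\<close> are functors. Taking domains and codomains in
  \<open>L\<close> turns it into the matching condition on objects, hence the flipped
  \<open>far_dom\<close> and \<open>far_cod\<close>.\<close>

lemma category_pairs_cat:
  assumes "cat_functor K L S" "cat_functor K L T"
  shows "category (pairs_cat K (fob S) (fob T) (far S) (far T))"
proof -
  interpret S: cat_functor K L S by fact
  interpret T: cat_functor K L T by fact
  show ?thesis
    by unfold_locales
      (auto simp: S.A.dom_obj S.A.cod_obj S.A.id_arr S.A.dom_id S.A.cod_id S.A.comp_arr S.A.dom_comp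
        S.A.cod_comp S.A.id_left S.A.id_right S.A.comp_assoc S.far_id T.far_id S.far_comp T.far_comp
        simp flip: S.far_dom S.far_cod T.far_dom T.far_cod)
qed

section \<open>Boundaries of formal squares over a decorated bicategory\<close>

locale free_double = decorated_bicategory B for B :: "('o, 'v, 'h, 't) dec_bicat"
begin

abbreviation "H \<equiv> Hom (Bic B)"
abbreviation "D \<equiv> Deco B"
abbreviation "Q \<equiv> freeQ B"
abbreviation src where "src \<equiv> bsrc (Bic B)"
abbreviation trg where "trg \<equiv> btrg (Bic B)"
abbreviation "unit1 \<equiv> bunit (Bic B)"
abbreviation "comp1 \<equiv> hob (bcomp (Bic B))"
abbreviation "comp2 \<equiv> har (bcomp (Bic B))"

lemmas hom_simps [simp] = bic.hom.dom_obj bic.hom.cod_obj bic.hom.id_arr bic.hom.dom_id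
  bic.hom.cod_id bic.hom.comp_arr bic.hom.dom_comp bic.hom.cod_comp bic.hom.id_left bic.hom.id_right

lemmas deco_simps [simp] = deco.dom_obj deco.cod_obj deco.id_arr deco.dom_id
  deco.cod_id deco.comp_arr deco.dom_comp deco.cod_comp deco.id_left deco.id_right

lemma bpairs_simps [simp]:
  "(\<beta>, \<alpha>) \<in> Obj (bpairs (Bic B)) \<longleftrightarrow> \<beta> \<in> Obj H \<and> \<alpha> \<in> Obj H \<and> src \<beta> = trg \<alpha>"
  "(\<psi>, \<phi>) \<in> Arr (bpairs (Bic B)) \<longleftrightarrow> \<psi> \<in> Arr H \<and> \<phi> \<in> Arr H \<and> src (Dom H \<psi>) = trg (Dom H \<phi>)"
  by (simp_all add: bpairs_def)

lemma comp_simps [simp]: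
  "\<lbrakk>\<beta> \<in> Obj H; \<alpha> \<in> Obj H; src \<beta> = trg \<alpha>\<rbrakk> \<Longrightarrow> comp1 \<beta> \<alpha> \<in> Obj H"
  "\<lbrakk>\<beta> \<in> Obj H; \<alpha> \<in> Obj H; src \<beta> = trg \<alpha>\<rbrakk> \<Longrightarrow> src (comp1 \<beta> \<alpha>) = src \<alpha>"
  "\<lbrakk>\<beta> \<in> Obj H; \<alpha> \<in> Obj H; src \<beta> = trg \<alpha>\<rbrakk> \<Longrightarrow> trg (comp1 \<beta> \<alpha>) = trg \<beta>"
  "\<lbrakk>\<beta> \<in> Obj H; \<alpha> \<in> Obj H; src \<beta> = trg \<alpha>\<rbrakk> \<Longrightarrow> comp2 (Idt H \<beta>) (Idt H \<alpha>) = Idt H (comp1 \<beta> \<alpha>)"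
  "\<lbrakk>\<psi> \<in> Arr H; \<phi> \<in> Arr H; src (Dom H \<psi>) = trg (Dom H \<phi>)\<rbrakk> \<Longrightarrow> comp2 \<psi> \<phi> \<in> Arr H"
  "\<lbrakk>\<psi> \<in> Arr H; \<phi> \<in> Arr H; src (Dom H \<psi>) = trg (Dom H \<phi>)\<rbrakk>
    \<Longrightarrow> Dom H (comp2 \<psi> \<phi>) = comp1 (Dom H \<psi>) (Dom H \<phi>)"
  "\<lbrakk>\<psi> \<in> Arr H; \<phi> \<in> Arr H; src (Dom H \<psi>) = trg (Dom H \<phi>)\<rbrakk>
    \<Longrightarrow> Cod H (comp2 \<psi> \<phi>) = comp1 (Cod H \<psi>) (Cod H \<phi>)"
  using bic.comp.fob_obj[of "(\<beta>, \<alpha>)"] bic.src_comp[of \<beta> \<alpha>] bic.trg_comp[of \<beta> \<alpha>]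
    bic.comp.far_id[of "(\<beta>, \<alpha>)"] bic.comp.far_arr[of "(\<psi>, \<phi>)"]
    bic.comp.far_dom[of "(\<psi>, \<phi>)"] bic.comp.far_cod[of "(\<psi>, \<phi>)"]
  by (simp_all, simp_all add: bpairs_def)

lemma zero_simps [simp]:
  "\<alpha> \<in> Obj H \<Longrightarrow> src \<alpha> \<in> Obj D"
  "\<alpha> \<in> Obj H \<Longrightarrow> trg \<alpha> \<in> Obj D"
  "\<phi> \<in> Arr H \<Longrightarrow> src (Cod H \<phi>) = src (Dom H \<phi>)"
  "\<phi> \<in> Arr H \<Longrightarrow> trg (Cod H \<phi>) = trg (Dom H \<phi>)"
  "a \<in> Obj D \<Longrightarrow> unit1 a \<in> Obj H"
  "a \<in> Obj D \<Longrightarrow> src (unit1 a) = a"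
  "a \<in> Obj D \<Longrightarrow> trg (unit1 a) = a"
  using deco_obj bic.src_zero bic.trg_zero bic.src_parallel bic.trg_parallel bic.unit_obj
    bic.src_unit bic.trg_unit by auto

lemma coherence_simps [simp]:
  "\<alpha> \<in> Obj H \<Longrightarrow> blunit (Bic B) \<alpha> \<in> Arr H"
  "\<alpha> \<in> Obj H \<Longrightarrow> Dom H (blunit (Bic B) \<alpha>) = comp1 (unit1 (trg \<alpha>)) \<alpha>"
  "\<alpha> \<in> Obj H \<Longrightarrow> Cod H (blunit (Bic B) \<alpha>) = \<alpha>"
  "\<alpha> \<in> Obj H \<Longrightarrow> brunit (Bic B) \<alpha> \<in> Arr H"
  "\<alpha> \<in> Obj H \<Longrightarrow> Dom H (brunit (Bic B) \<alpha>) = comp1 \<alpha> (unit1 (src \<alpha>))"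
  "\<alpha> \<in> Obj H \<Longrightarrow> Cod H (brunit (Bic B) \<alpha>) = \<alpha>"
  "\<lbrakk>\<gamma> \<in> Obj H; \<beta> \<in> Obj H; \<alpha> \<in> Obj H; src \<gamma> = trg \<beta>; src \<beta> = trg \<alpha>\<rbrakk>
    \<Longrightarrow> bassoc (Bic B) \<gamma> \<beta> \<alpha> \<in> Arr H"
  "\<lbrakk>\<gamma> \<in> Obj H; \<beta> \<in> Obj H; \<alpha> \<in> Obj H; src \<gamma> = trg \<beta>; src \<beta> = trg \<alpha>\<rbrakk>
    \<Longrightarrow> Dom H (bassoc (Bic B) \<gamma> \<beta> \<alpha>) = comp1 (comp1 \<gamma> \<beta>) \<alpha>"
  "\<lbrakk>\<gamma> \<in> Obj H; \<beta> \<in> Obj H; \<alpha> \<in> Obj H; src \<gamma> = trg \<beta>; src \<beta> = trg \<alpha>\<rbrakk>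
    \<Longrightarrow> Cod H (bassoc (Bic B) \<gamma> \<beta> \<alpha>) = comp1 \<gamma> (comp1 \<beta> \<alpha>)"
  using bic.lunit_iso bic.lunit_dom bic.lunit_cod bic.runit_iso bic.runit_dom bic.runit_cod
    bic.assoc_iso[of \<gamma> \<beta> \<alpha>] bic.assoc_dom[of \<gamma> \<beta> \<alpha>] bic.assoc_cod[of \<gamma> \<beta> \<alpha>]
  by (auto simp: iso_in_def)

text \<open>The corners of a formal square can be read off from its vertical edges or from its top
  and bottom, with the same result. This is what makes tops and bottoms composable as soon as edges
  match.\<close>

lemma formal_boundary_simps [simp]:
  assumes "formal_square B \<Phi>"
  shows "ftop B \<Phi> \<in> Obj H" and "fbot B \<Phi> \<in> Obj H"
    and "fleft B \<Phi> \<in> Arr D" and "fright B \<Phi> \<in> Arr D"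
    and "Dom D (fleft B \<Phi>) = src (ftop B \<Phi>)" and "Cod D (fleft B \<Phi>) = src (fbot B \<Phi>)"
    and "Dom D (fright B \<Phi>) = trg (ftop B \<Phi>)" and "Cod D (fright B \<Phi>) = trg (fbot B \<Phi>)"
proof -
  have "ftop B \<Phi> \<in> Obj H \<and> fbot B \<Phi> \<in> Obj H \<and> fleft B \<Phi> \<in> Arr D \<and> fright B \<Phi> \<in> Arr D \<and>
    Dom D (fleft B \<Phi>) = src (ftop B \<Phi>) \<and> Cod D (fleft B \<Phi>) = src (fbot B \<Phi>) \<and>
    Dom D (fright B \<Phi>) = trg (ftop B \<Phi>) \<and> Cod D (fright B \<Phi>) = trg (fbot B \<Phi>)"
    using assms
  proof (induction \<Phi>)
    case (FH \<Psi> \<Phi>)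
    \<comment> \<open>These are the domain and the codomain of the common vertical edge.\<close>
    then have "src (ftop B \<Psi>) = trg (ftop B \<Phi>)" "src (fbot B \<Psi>) = trg (fbot B \<Phi>)"
      by (metis formal_square.simps(4))+
    with FH show ?case by simp
  qed auto
  then show "ftop B \<Phi> \<in> Obj H" and "fbot B \<Phi> \<in> Obj H"
    and "fleft B \<Phi> \<in> Arr D" and "fright B \<Phi> \<in> Arr D"
    and "Dom D (fleft B \<Phi>) = src (ftop B \<Phi>)" and "Cod D (fleft B \<Phi>) = src (fbot B \<Phi>)"
    and "Dom D (fright B \<Phi>) = trg (ftop B \<Phi>)" and "Cod D (fright B \<Phi>) = trg (fbot B \<Phi>)"
    by blast+
qed

lemma Idt_deco_simps [simp]:
  "a \<in> Obj D \<Longrightarrow> Comp D (Idt D a) (Idt D a) = Idt D a"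
  "\<lbrakk>a \<in> Obj D; b \<in> Obj D\<rbrakk> \<Longrightarrow> Idt D a = Idt D b \<longleftrightarrow> a = b"
  using deco.id_left[of "Idt D a"] deco.dom_id by (auto, metis)

lemma FH_objects:
  assumes "formal_square B (FH \<Psi> \<Phi>)"
  shows "src (ftop B \<Psi>) = trg (ftop B \<Phi>)" "src (fbot B \<Psi>) = trg (fbot B \<Phi>)"
  using assms formal_boundary_simps(5-8) by (metis formal_square.simps(4))+

text \<open>This makes the boundary maps of \<open>freeQ\<close> well defined on classes. In the
  unit and naturality relations the extra 2-cells have identity edges, which disappear by the unit
  laws of \<open>D\<close>.\<close>

lemma fequiv_boundary:
  assumes "fequiv B \<Phi> \<Psi>"
  shows "formal_square B \<Phi> \<and> formal_square B \<Psi> \<and> ftop B \<Phi> = ftop B \<Psi> \<and> fbot B \<Phi> = fbot B \<Psi> \<and>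
    fleft B \<Phi> = fleft B \<Psi> \<and> fright B \<Phi> = fright B \<Psi>"
  using assms
proof induction
  case (v_assoc \<Theta> \<Psi> \<Phi>)
  then show ?case by (auto simp: deco.comp_assoc)
next
  case (v_id_left \<Phi>)
  \<comment> \<open>The flipped rules write the corner as the codomain of an edge, the form in which
    \<open>id_left\<close> applies.\<close>
  then show ?case by (auto simp flip: formal_boundary_simps(6,8))
next
  case (v_id_right \<Phi>)
  then show ?case by (auto simp flip: formal_boundary_simps(5,7))
next
  case (v_cell \<psi> \<phi>)
  then show ?case by (auto simp flip: zero_simps(3,4))
next
  case (lunit_nat \<Phi>)
  then show ?case by (auto simp flip: formal_boundary_simps(5-8))
next
  case (runit_nat \<Phi>)
  then show ?case by (auto simp flip: formal_boundary_simps(5-8))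
next
  case (assoc_nat \<Theta> \<Psi> \<Phi>)
  then show ?case using FH_objects[of \<Theta> \<Psi>] FH_objects[of \<Psi> \<Phi>]
    by (auto simp flip: formal_boundary_simps(5-8))
qed auto

section \<open>Classes of formal squares and the operations induced on them\<close>

lemma mem_fclass [simp]: "\<Psi> \<in> fclass B \<Phi> \<longleftrightarrow> fequiv B \<Phi> \<Psi>"
  by (simp add: fclass_def frel_def)

lemma fclass_eqI: "fequiv B \<Phi> \<Psi> \<Longrightarrow> fclass B \<Phi> = fclass B \<Psi>"
  by (rule set_eqI) (auto intro: fequiv.sym fequiv.trans)

lemma Q_arr: "X \<in> Arr (C1 Q) \<longleftrightarrow> (\<exists>\<Phi>. formal_square B \<Phi> \<and> X = fclass B \<Phi>)"
  by (auto simp: freeQ_def quotient_def fclass_def)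

lemma Q_arrI [simp]: "formal_square B \<Phi> \<Longrightarrow> fclass B \<Phi> \<in> Arr (C1 Q)"
  by (auto simp: Q_arr)

lemma Q_arrE:
  assumes "X \<in> Arr (C1 Q)"
  obtains \<Phi> where "formal_square B \<Phi>" and "X = fclass B \<Phi>"
  using assms by (auto simp: Q_arr)

text \<open>Any invariant of \<open>fequiv\<close> descends to classes. The four boundary maps are
  handled this way, and later the value in \<open>C\<close>.\<close>

lemma the_elem_image_fclass:
  assumes "formal_square B \<Phi>" and "\<And>\<Psi>. fequiv B \<Phi> \<Psi> \<Longrightarrow> g \<Psi> = g \<Phi>"
  shows "the_elem (g ` fclass B \<Phi>) = g \<Phi>"
proof -
  have "g ` fclass B \<Phi> = {g \<Phi>}"
    using assms by (auto intro!: image_eqI[of _ _ \<Phi>] fequiv.refl)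
  then show ?thesis by simp
qed

lemma Q_simps [simp]:
  "C0 Q = D"
  "Obj (C1 Q) = Obj H"
  "Idt (C1 Q) \<alpha> = fclass B (FCell (Idt H \<alpha>))"
  "fob (sfun Q) = src"
  "fob (tfun Q) = trg"
  "fob (ifun Q) = unit1"
  "far (ifun Q) f = fclass B (FId f)"
  "hob (hcomp Q) \<beta> \<alpha> = comp1 \<beta> \<alpha>"
  "assoc Q \<gamma> \<beta> \<alpha> = fclass B (FCell (bassoc (Bic B) \<gamma> \<beta> \<alpha>))"
  "lunit Q \<alpha> = fclass B (FCell (blunit (Bic B) \<alpha>))"
  "runit Q \<alpha> = fclass B (FCell (brunit (Bic B) \<alpha>))"
  by (simp_all add: freeQ_def)

lemma Q_boundary_simps [simp]:
  assumes "formal_square B \<Phi>"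
  shows "Dom (C1 Q) (fclass B \<Phi>) = ftop B \<Phi>" and "Cod (C1 Q) (fclass B \<Phi>) = fbot B \<Phi>"
    and "far (sfun Q) (fclass B \<Phi>) = fleft B \<Phi>" and "far (tfun Q) (fclass B \<Phi>) = fright B \<Phi>"
  using assms by (simp_all add: freeQ_def the_elem_image_fclass fequiv_boundary)

text \<open>By \<open>cong_v\<close> every choice of representatives contributes the same class, and
  the index sets are nonempty, so the union is that class. \<open>fequiv_boundary\<close> guarantees
  that the other representatives are composable too.\<close>

lemma Q_comp [simp]:
  assumes "formal_square B \<Psi>" and "formal_square B \<Phi>" and "fbot B \<Phi> = ftop B \<Psi>"
  shows "Comp (C1 Q) (fclass B \<Psi>) (fclass B \<Phi>) = fclass B (FV \<Psi> \<Phi>)"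
proof -
  have "fclass B (FV \<Psi>' \<Phi>') = fclass B (FV \<Psi> \<Phi>)" if "fequiv B \<Psi> \<Psi>'" "fequiv B \<Phi> \<Phi>'" for \<Psi>' \<Phi>'
    using that assms fequiv_boundary[of \<Psi> \<Psi>'] fequiv_boundary[of \<Phi> \<Phi>']
    by (intro fclass_eqI fequiv.cong_v) (auto intro: fequiv.sym)
  then have "(\<Union>\<Psi>'\<in>fclass B \<Psi>. \<Union>\<Phi>'\<in>fclass B \<Phi>. fclass B (FV \<Psi>' \<Phi>'))
      = (\<Union>\<Psi>'\<in>fclass B \<Psi>. \<Union>\<Phi>'\<in>fclass B \<Phi>. fclass B (FV \<Psi> \<Phi>))"
    by (intro SUP_cong) simp_all
  moreover have "\<Psi> \<in> fclass B \<Psi>" "\<Phi> \<in> fclass B \<Phi>"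
    using assms by (auto intro: fequiv.refl)
  ultimately show ?thesis
    by (auto simp: freeQ_def)
qed

lemma Q_hcomp [simp]:
  assumes "formal_square B \<Psi>" and "formal_square B \<Phi>" and "fright B \<Phi> = fleft B \<Psi>"
  shows "har (hcomp Q) (fclass B \<Psi>) (fclass B \<Phi>) = fclass B (FH \<Psi> \<Phi>)"
proof -
  have "fclass B (FH \<Psi>' \<Phi>') = fclass B (FH \<Psi> \<Phi>)" if "fequiv B \<Psi> \<Psi>'" "fequiv B \<Phi> \<Phi>'" for \<Psi>' \<Phi>'
    using that assms fequiv_boundary[of \<Psi> \<Psi>'] fequiv_boundary[of \<Phi> \<Phi>']
    by (intro fclass_eqI fequiv.cong_h) (auto intro: fequiv.sym)
  then have "(\<Union>\<Psi>'\<in>fclass B \<Psi>. \<Union>\<Phi>'\<in>fclass B \<Phi>. fclass B (FH \<Psi>' \<Phi>'))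
      = (\<Union>\<Psi>'\<in>fclass B \<Psi>. \<Union>\<Phi>'\<in>fclass B \<Phi>. fclass B (FH \<Psi> \<Phi>))"
    by (intro SUP_cong) simp_all
  moreover have "\<Psi> \<in> fclass B \<Psi>" "\<Phi> \<in> fclass B \<Phi>"
    using assms by (auto intro: fequiv.refl)
  ultimately show ?thesis
    by (auto simp: freeQ_def)
qed

text \<open>The relations on generators, oriented so that composites of 2-cells, or of horizontal
  identities, collapse to one generator. Equations between 2-cells of \<open>B\<close> thereby
  transfer to \<open>Q\<close>.\<close>

lemma cell_simps [simp]:
  "a \<in> Obj D \<Longrightarrow> fclass B (FId (Idt D a)) = fclass B (FCell (Idt H (unit1 a)))"
  "\<lbrakk>f \<in> Arr D; g \<in> Arr D; Cod D f = Dom D g\<rbrakk>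
    \<Longrightarrow> fclass B (FV (FId g) (FId f)) = fclass B (FId (Comp D g f))"
  "\<lbrakk>\<psi> \<in> Arr H; \<phi> \<in> Arr H; Cod H \<phi> = Dom H \<psi>\<rbrakk>
    \<Longrightarrow> fclass B (FV (FCell \<psi>) (FCell \<phi>)) = fclass B (FCell (Comp H \<psi> \<phi>))"
  "\<lbrakk>\<psi> \<in> Arr H; \<phi> \<in> Arr H; src (Dom H \<psi>) = trg (Dom H \<phi>)\<rbrakk>
    \<Longrightarrow> fclass B (FH (FCell \<psi>) (FCell \<phi>)) = fclass B (FCell (comp2 \<psi> \<phi>))"
  by (simp_all add: fclass_eqI fequiv.hor_id_id fequiv.v_hor_id fequiv.v_cell fequiv.h_cell)

lemma fclass_simps [simp]:
  "formal_square B (FV (FV \<Theta> \<Psi>) \<Phi>) \<Longrightarrow> fclass B (FV (FV \<Theta> \<Psi>) \<Phi>) = fclass B (FV \<Theta> (FV \<Psi> \<Phi>))"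
  "formal_square B \<Phi> \<Longrightarrow> fclass B (FV (FCell (Idt H (fbot B \<Phi>))) \<Phi>) = fclass B \<Phi>"
  "formal_square B \<Phi> \<Longrightarrow> fclass B (FV \<Phi> (FCell (Idt H (ftop B \<Phi>)))) = fclass B \<Phi>"
  "formal_square B \<Phi> \<Longrightarrow>
    fclass B (FV (FCell (blunit (Bic B) (fbot B \<Phi>))) (FH (FId (fright B \<Phi>)) \<Phi>))
    = fclass B (FV \<Phi> (FCell (blunit (Bic B) (ftop B \<Phi>))))"
  "formal_square B \<Phi> \<Longrightarrow>
    fclass B (FV (FCell (brunit (Bic B) (fbot B \<Phi>))) (FH \<Phi> (FId (fleft B \<Phi>))))
    = fclass B (FV \<Phi> (FCell (brunit (Bic B) (ftop B \<Phi>))))"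
  by (simp_all only: fclass_eqI fequiv.v_assoc fequiv.v_id_left fequiv.v_id_right
      fequiv.lunit_nat fequiv.runit_nat)

text \<open>This is \<open>assoc_nat\<close> read in \<open>Q\<close>. The shared edges make the
  tops and the bottoms composable, so the associators at both ends are formal squares.\<close>

lemma Q_assoc_natural:
  assumes "formal_square B (FH \<Theta> \<Psi>)" and "formal_square B (FH \<Psi> \<Phi>)"
  shows "Comp (C1 Q) (fclass B (FCell (bassoc (Bic B) (fbot B \<Theta>) (fbot B \<Psi>) (fbot B \<Phi>))))
      (fclass B (FH (FH \<Theta> \<Psi>) \<Phi>))
    = Comp (C1 Q) (fclass B (FH \<Theta> (FH \<Psi> \<Phi>)))
      (fclass B (FCell (bassoc (Bic B) (ftop B \<Theta>) (ftop B \<Psi>) (ftop B \<Phi>))))"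
  using assms FH_objects[OF assms(1)] FH_objects[OF assms(2)]
  by (simp add: fclass_eqI[OF fequiv.assoc_nat])

lemma globular_cell: "\<phi> \<in> Arr H \<Longrightarrow> globular Q (fclass B (FCell \<phi>))"
  by (auto simp: globular_def)

text \<open>Passing to classes respects vertical composites and identities of 2-cells, so the class
  of an inverse is an inverse.\<close>

lemma iso_cell:
  assumes "iso_in H \<phi>"
  shows "iso_in (C1 Q) (fclass B (FCell \<phi>))"
proof -
  obtain \<psi> where "\<phi> \<in> Arr H" "\<psi> \<in> Arr H" "Dom H \<psi> = Cod H \<phi>" "Cod H \<psi> = Dom H \<phi>"
    "Comp H \<psi> \<phi> = Idt H (Dom H \<phi>)" "Comp H \<phi> \<psi> = Idt H (Cod H \<phi>)"
    using assms by (auto simp: iso_in_def)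
  then show ?thesis
    unfolding iso_in_def by (auto intro!: bexI[of _ "fclass B (FCell \<psi>)"])
qed

section \<open>The double category structure of \<open>Q\<close>\<close>

lemma Q_category: "category (C1 Q)"
  by unfold_locales
    (auto elim!: Q_arrE simp del: mem_fclass)

lemma Q_sfun: "cat_functor (C1 Q) D (sfun Q)"
  by (intro cat_functor.intro Q_category deco.category_axioms, unfold_locales) (auto elim!: Q_arrE)

lemma Q_tfun: "cat_functor (C1 Q) D (tfun Q)"
  by (intro cat_functor.intro Q_category deco.category_axioms, unfold_locales) (auto elim!: Q_arrE)

text \<open>Preservation of identities is \<open>hor_id_id\<close>, preservation of composites is
  \<open>v_hor_id\<close>.\<close>

lemma Q_ifun: "cat_functor D (C1 Q) (ifun Q)"
  by (intro cat_functor.intro Q_category deco.category_axioms, unfold_locales) auto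

lemma hpairs_simps [simp]:
  "(\<beta>, \<alpha>) \<in> Obj (hpairs Q) \<longleftrightarrow> \<beta> \<in> Obj H \<and> \<alpha> \<in> Obj H \<and> src \<beta> = trg \<alpha>"
  "(Y, X) \<in> Arr (hpairs Q) \<longleftrightarrow> Y \<in> Arr (C1 Q) \<and> X \<in> Arr (C1 Q) \<and> far (sfun Q) Y = far (tfun Q) X"
  by (simp_all add: hpairs_def)

lemma Q_hpairs_category: "category (hpairs Q)"
  unfolding hpairs_def by (rule category_pairs_cat[OF Q_sfun Q_tfun])

text \<open>Composites are preserved by \<open>interchange\<close>. Identities are preserved because
  \<open>h_cell\<close> reduces the claim to functoriality of \<open>bcomp\<close> in
  \<open>B\<close>.\<close>

lemma Q_hcomp_functor: "cat_functor (hpairs Q) (C1 Q) (hcomp Q)"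
proof (intro cat_functor.intro Q_category Q_hpairs_category, unfold_locales)
  fix p assume "p \<in> Obj (hpairs Q)"
  then show "fob (hcomp Q) p \<in> Obj (C1 Q)"
    by (cases p) simp
next
  fix p assume "p \<in> Obj (hpairs Q)"
  then show "far (hcomp Q) (Idt (hpairs Q) p) = Idt (C1 Q) (fob (hcomp Q) p)"
    by (cases p) (simp, simp add: hpairs_def)
next
  fix p assume p: "p \<in> Arr (hpairs Q)"
  obtain \<Psi> \<Phi> where *: "p = (fclass B \<Psi>, fclass B \<Phi>)" "formal_square B (FH \<Psi> \<Phi>)"
    using p by (cases p) (auto elim!: Q_arrE)
  then show "far (hcomp Q) p \<in> Arr (C1 Q)" by simp
  show "Dom (C1 Q) (far (hcomp Q) p) = fob (hcomp Q) (Dom (hpairs Q) p)"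
    using * by (simp add: hpairs_def)
  show "Cod (C1 Q) (far (hcomp Q) p) = fob (hcomp Q) (Cod (hpairs Q) p)"
    using * by (simp add: hpairs_def)
next
  fix p q assume pq: "p \<in> Arr (hpairs Q)" "q \<in> Arr (hpairs Q)" "Cod (hpairs Q) p = Dom (hpairs Q) q"
  obtain \<Psi> \<Phi> where p: "p = (fclass B \<Psi>, fclass B \<Phi>)" "formal_square B (FH \<Psi> \<Phi>)"
    using pq(1) by (cases p) (auto elim!: Q_arrE)
  obtain \<Psi>' \<Phi>' where q: "q = (fclass B \<Psi>', fclass B \<Phi>')" "formal_square B (FH \<Psi>' \<Phi>')"
    using pq(2) by (cases q) (auto elim!: Q_arrE)
  have m: "fbot B \<Psi> = ftop B \<Psi>'" "fbot B \<Phi> = ftop B \<Phi>'"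
    using pq(3) p q by (auto simp: hpairs_def)
  show "far (hcomp Q) (Comp (hpairs Q) q p) = Comp (C1 Q) (far (hcomp Q) q) (far (hcomp Q) p)"
    using p q m by (auto simp: hpairs_def intro!: fclass_eqI fequiv.interchange)
qed

text \<open>Pentagon and triangle involve only 2-cells, so they are inherited from \<open>B\<close>;
  the naturality axioms are imposed by the relations.\<close>

lemma freeQ_double_category: "double_category Q"
proof (intro double_category.intro)
  \<comment> \<open>The unit sits at \<open>trg \<alpha>\<close> instead of
    \<open>src \<beta>\<close>, because the simplifier rewrites along
    \<open>src \<beta> = trg \<alpha>\<close>.\<close>
  have triangle: "Comp H (comp2 (Idt H \<beta>) (blunit (Bic B) \<alpha>)) (bassoc (Bic B) \<beta> (unit1 (trg \<alpha>)) \<alpha>)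
      = comp2 (brunit (Bic B) \<beta>) (Idt H \<alpha>)"
    if "\<beta> \<in> Obj H" "\<alpha> \<in> Obj H" "src \<beta> = trg \<alpha>" for \<beta> \<alpha>
    using bic.triangle[of \<beta> \<alpha>] that by simp
  show "double_category_axioms Q"
    by unfold_locales
      (auto elim!: Q_arrE intro!: globular_cell iso_cell
        simp: Q_assoc_natural bic.assoc_iso bic.lunit_iso bic.runit_iso bic.pentagon triangle
        simp del: mem_fclass)
qed (simp_all add: Q_category Q_sfun Q_tfun Q_ifun Q_hcomp_functor deco.category_axioms)

end

section \<open>Values of formal squares in \<open>C\<close>\<close>

primrec fexp_value :: "('o, 'v, 'h, 's) dblcat \<Rightarrow> ('v, 's) fexp \<Rightarrow> 's" where
  "fexp_value C (FCell \<phi>) = \<phi>"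
| "fexp_value C (FId f) = far (ifun C) f"
| "fexp_value C (FV \<Psi> \<Phi>) = Comp (C1 C) (fexp_value C \<Psi>) (fexp_value C \<Phi>)"
| "fexp_value C (FH \<Psi> \<Phi>) = har (hcomp C) (fexp_value C \<Psi>) (fexp_value C \<Phi>)"

locale free_double_over = free_double B + C: double_category C
  for B :: "('o, 'v, 'h, 't) dec_bicat" and C :: "('o, 'v, 'h, 't) dblcat" +
  assumes Hstar_eq: "dec_bicat_eq (Hstar C) B"
begin

abbreviation "val \<equiv> fexp_value C"

text \<open>Here and in the next lemmas, data of \<open>C\<close> are rewritten to data of
  \<open>B\<close>. Most rules carry carrier conditions, since equality of structures asserts
  agreement only there.\<close>

lemma C0_simps [simp]:
  "Obj (C0 C) = Obj D"
  "Arr (C0 C) = Arr D"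
  "f \<in> Arr D \<Longrightarrow> Dom (C0 C) f = Dom D f"
  "f \<in> Arr D \<Longrightarrow> Cod (C0 C) f = Cod D f"
  "a \<in> Obj D \<Longrightarrow> Idt (C0 C) a = Idt D a"
  "\<lbrakk>f \<in> Arr D; g \<in> Arr D; Cod D f = Dom D g\<rbrakk> \<Longrightarrow> Comp (C0 C) g f = Comp D g f"
  using Hstar_eq by (auto simp: dec_bicat_eq_def cat_eq_def Hstar_def)

lemma globular_iff [simp]: "globular C \<phi> \<longleftrightarrow> \<phi> \<in> Arr H"
  using Hstar_eq
  by (auto simp: dec_bicat_eq_def bicat_eq_def cat_eq_def Hstar_def horizontal_bicat_def)

lemma hor_simps [simp]:
  "Obj (C1 C) = Obj H"
  "\<phi> \<in> Arr H \<Longrightarrow> Dom (C1 C) \<phi> = Dom H \<phi>"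
  "\<phi> \<in> Arr H \<Longrightarrow> Cod (C1 C) \<phi> = Cod H \<phi>"
  "\<alpha> \<in> Obj H \<Longrightarrow> Idt (C1 C) \<alpha> = Idt H \<alpha>"
  "\<lbrakk>\<phi> \<in> Arr H; \<psi> \<in> Arr H; Cod H \<phi> = Dom H \<psi>\<rbrakk> \<Longrightarrow> Comp (C1 C) \<psi> \<phi> = Comp H \<psi> \<phi>"
  "\<alpha> \<in> Obj H \<Longrightarrow> fob (sfun C) \<alpha> = src \<alpha>"
  "\<alpha> \<in> Obj H \<Longrightarrow> fob (tfun C) \<alpha> = trg \<alpha>"
  "a \<in> Obj D \<Longrightarrow> fob (ifun C) a = unit1 a"
  "\<alpha> \<in> Obj H \<Longrightarrow> lunit C \<alpha> = blunit (Bic B) \<alpha>"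
  "\<alpha> \<in> Obj H \<Longrightarrow> runit C \<alpha> = brunit (Bic B) \<alpha>"
  using Hstar_eq
  by (auto simp: dec_bicat_eq_def bicat_eq_def cat_eq_def Hstar_def horizontal_bicat_def deco_obj)

lemma hor_comp_simps [simp]:
  "\<lbrakk>\<beta> \<in> Obj H; \<alpha> \<in> Obj H; src \<beta> = trg \<alpha>\<rbrakk> \<Longrightarrow> hob (hcomp C) \<beta> \<alpha> = comp1 \<beta> \<alpha>"
  "\<lbrakk>\<psi> \<in> Arr H; \<phi> \<in> Arr H; src (Dom H \<psi>) = trg (Dom H \<phi>)\<rbrakk>
    \<Longrightarrow> har (hcomp C) \<psi> \<phi> = comp2 \<psi> \<phi>"
  "\<lbrakk>\<gamma> \<in> Obj H; \<beta> \<in> Obj H; \<alpha> \<in> Obj H; src \<gamma> = trg \<beta>; src \<beta> = trg \<alpha>\<rbrakk>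
    \<Longrightarrow> assoc C \<gamma> \<beta> \<alpha> = bassoc (Bic B) \<gamma> \<beta> \<alpha>"
  using Hstar_eq
  by (auto simp: dec_bicat_eq_def bicat_eq_def functor_eq_def Hstar_def horizontal_bicat_def bpairs_def)

text \<open>Globularity yields identities on some objects as edges; the domain of each edge, a
  corner of the square, tells which objects they are.\<close>

lemma cell_edges [simp]:
  assumes "\<phi> \<in> Arr H"
  shows "\<phi> \<in> Arr (C1 C)" and "far (sfun C) \<phi> = Idt D (src (Dom H \<phi>))"
    and "far (tfun C) \<phi> = Idt D (trg (Dom H \<phi>))"
proof -
  have \<phi>: "globular C \<phi>" using assms by simp
  then show arr: "\<phi> \<in> Arr (C1 C)" by (simp only: globular_def)
  obtain a b where "a \<in> Obj D" "far (sfun C) \<phi> = Idt D a" "b \<in> Obj D" "far (tfun C) \<phi> = Idt D b"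
    using \<phi> unfolding globular_def by auto
  with C.s.far_dom[OF arr] C.t.far_dom[OF arr] assms
  show "far (sfun C) \<phi> = Idt D (src (Dom H \<phi>))" "far (tfun C) \<phi> = Idt D (trg (Dom H \<phi>))"
    by auto
qed

lemma hpairs_C_simps [simp]:
  "(\<beta>, \<alpha>) \<in> Obj (hpairs C) \<longleftrightarrow> \<beta> \<in> Obj H \<and> \<alpha> \<in> Obj H \<and> src \<beta> = trg \<alpha>"
  "(\<Psi>, \<Phi>) \<in> Arr (hpairs C)
    \<longleftrightarrow> \<Psi> \<in> Arr (C1 C) \<and> \<Phi> \<in> Arr (C1 C) \<and> far (sfun C) \<Psi> = far (tfun C) \<Phi>"
  by (auto simp: hpairs_def)

lemma square_simps [simp]:
  "f \<in> Arr D \<Longrightarrow> far (ifun C) f \<in> Arr (C1 C)"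
  "f \<in> Arr D \<Longrightarrow> Dom (C1 C) (far (ifun C) f) = unit1 (Dom D f)"
  "f \<in> Arr D \<Longrightarrow> Cod (C1 C) (far (ifun C) f) = unit1 (Cod D f)"
  "f \<in> Arr D \<Longrightarrow> far (sfun C) (far (ifun C) f) = f"
  "f \<in> Arr D \<Longrightarrow> far (tfun C) (far (ifun C) f) = f"
  "\<lbrakk>\<Phi> \<in> Arr (C1 C); \<Psi> \<in> Arr (C1 C); Cod (C1 C) \<Phi> = Dom (C1 C) \<Psi>\<rbrakk>
    \<Longrightarrow> far (sfun C) (Comp (C1 C) \<Psi> \<Phi>) = Comp (C0 C) (far (sfun C) \<Psi>) (far (sfun C) \<Phi>)"
  "\<lbrakk>\<Phi> \<in> Arr (C1 C); \<Psi> \<in> Arr (C1 C); Cod (C1 C) \<Phi> = Dom (C1 C) \<Psi>\<rbrakk>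
    \<Longrightarrow> far (tfun C) (Comp (C1 C) \<Psi> \<Phi>) = Comp (C0 C) (far (tfun C) \<Psi>) (far (tfun C) \<Phi>)"
  "\<lbrakk>\<Psi> \<in> Arr (C1 C); \<Phi> \<in> Arr (C1 C); far (sfun C) \<Psi> = far (tfun C) \<Phi>\<rbrakk>
    \<Longrightarrow> har (hcomp C) \<Psi> \<Phi> \<in> Arr (C1 C)"
  "\<lbrakk>\<Psi> \<in> Arr (C1 C); \<Phi> \<in> Arr (C1 C); far (sfun C) \<Psi> = far (tfun C) \<Phi>\<rbrakk>
    \<Longrightarrow> Dom (C1 C) (har (hcomp C) \<Psi> \<Phi>) = hob (hcomp C) (Dom (C1 C) \<Psi>) (Dom (C1 C) \<Phi>)"
  "\<lbrakk>\<Psi> \<in> Arr (C1 C); \<Phi> \<in> Arr (C1 C); far (sfun C) \<Psi> = far (tfun C) \<Phi>\<rbrakk>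
    \<Longrightarrow> Cod (C1 C) (har (hcomp C) \<Psi> \<Phi>) = hob (hcomp C) (Cod (C1 C) \<Psi>) (Cod (C1 C) \<Phi>)"
  using C.i.far_arr[of f] C.i.far_dom[of f] C.i.far_cod[of f] C.s_i_arr[of f] C.t_i_arr[of f]
    C.s.far_comp[of \<Phi> \<Psi>] C.t.far_comp[of \<Phi> \<Psi>] C.hcomp.far_arr[of "(\<Psi>, \<Phi>)"]
    C.hcomp.far_dom[of "(\<Psi>, \<Phi>)"] C.hcomp.far_cod[of "(\<Psi>, \<Phi>)"]
  by (simp_all, simp_all add: hpairs_def)

text \<open>Formal composability thus becomes composability in \<open>C\<close>, which discharges
  the side conditions of the axioms of \<open>C\<close> below.\<close>

lemma fexp_value_boundary:
  assumes "formal_square B \<Phi>"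
  shows "val \<Phi> \<in> Arr (C1 C) \<and> Dom (C1 C) (val \<Phi>) = ftop B \<Phi> \<and> Cod (C1 C) (val \<Phi>) = fbot B \<Phi> \<and>
    far (sfun C) (val \<Phi>) = fleft B \<Phi> \<and> far (tfun C) (val \<Phi>) = fright B \<Phi>"
  using assms
proof (induction \<Phi>)
  case (FV \<Psi> \<Phi>)
  then show ?case
    by (simp add: C.C1.comp_arr C.C1.dom_comp C.C1.cod_comp)
next
  case (FH \<Psi> \<Phi>)
  then show ?case
    using FH_objects[OF FH.prems] by (simp add: C.s_comp_arr C.t_comp_arr)
qed simp_all

text \<open>Interchange is functoriality of \<open>hcomp C\<close>, and the relations on horizontal
  identities are functoriality of \<open>ifun C\<close>. The cases \<open>v_cell\<close> and
  \<open>h_cell\<close> hold since both compositions of \<open>C\<close> restrict to those of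
  \<open>B\<close> on 2-cells.\<close>

lemma fequiv_sound: "fequiv B \<Phi> \<Psi> \<Longrightarrow> val \<Phi> = val \<Psi>"
proof (induction rule: fequiv.induct)
  case (hor_id_id a)
  then show ?case using C.i.far_id[of a] by simp
next
  case (v_assoc \<Theta> \<Psi> \<Phi>)
  then show ?case by (simp add: C.C1.comp_assoc fexp_value_boundary)
next
  case (v_id_left \<Phi>)
  then show ?case using C.C1.id_left[of "val \<Phi>"] by (simp add: fexp_value_boundary)
next
  case (v_id_right \<Phi>)
  then show ?case using C.C1.id_right[of "val \<Phi>"] by (simp add: fexp_value_boundary)
next
  case (interchange \<Psi>2 \<Psi>1 \<Phi>2 \<Phi>1)
  then show ?case
    using C.hcomp.far_comp[of "(val \<Psi>1, val \<Phi>1)" "(val \<Psi>2, val \<Phi>2)"]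
    \<comment> \<open>Membership of the pairs in \<open>hpairs C\<close> is settled first; then the
      pair category is unfolded to compute its composites.\<close>
    by (simp add: fexp_value_boundary) (simp add: hpairs_def fexp_value_boundary)
next
  case (v_hor_id f g)
  then show ?case using C.i.far_comp[of f g] by simp
next
  case (lunit_nat \<Phi>)
  then show ?case using C.lunit_natural[of "val \<Phi>"] by (simp add: fexp_value_boundary)
next
  case (runit_nat \<Phi>)
  then show ?case using C.runit_natural[of "val \<Phi>"] by (simp add: fexp_value_boundary)
next
  case (assoc_nat \<Theta> \<Psi> \<Phi>)
  then show ?case
    using C.assoc_natural[of "val \<Theta>" "val \<Psi>" "val \<Phi>"] FH_objects[of \<Theta> \<Psi>] FH_objects[of \<Psi> \<Phi>]
    by (simp add: fexp_value_boundary)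
qed simp_all

section \<open>Existence and uniqueness of the projection\<close>

definition proj :: "('o, 'v, 'h, ('v, 't) fexp set, 'o, 'v, 'h, 't) dblfun" where
  "proj = (\<lparr>fob = id, far = id\<rparr>, \<lparr>fob = id, far = (\<lambda>X. the_elem (val ` X))\<rparr>)"

lemma proj_simps [simp]:
  "fob (fst proj) a = a"
  "far (fst proj) f = f"
  "fob (snd proj) \<alpha> = \<alpha>"
  "formal_square B \<Phi> \<Longrightarrow> far (snd proj) (fclass B \<Phi>) = val \<Phi>"
  by (simp_all add: proj_def the_elem_image_fclass fequiv_sound[symmetric])

text \<open>On representatives \<open>val\<close> is defined by recursion through both compositions,
  so preserving them is immediate; edges, tops and bottoms come from
  \<open>fexp_value_boundary\<close>. The identity serves on objects, vertical morphisms and 1-cells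
  because \<open>C\<close> shares them with \<open>B\<close>.\<close>

lemma strict_double_functor_proj: "strict_double_functor Q C proj"
proof (intro strict_double_functor.intro freeQ_double_category C.double_category_axioms)
  show "cat_functor (C0 Q) (C0 C) (fst proj)"
    by (intro cat_functor.intro, simp add: deco.category_axioms, rule C.C0.category_axioms, unfold_locales)
      simp_all
  show "cat_functor (C1 Q) (C1 C) (snd proj)"
    by (intro cat_functor.intro Q_category C.C1.category_axioms, unfold_locales)
      (auto elim!: Q_arrE simp: fexp_value_boundary)
  show "strict_double_functor_axioms Q C proj"
    by unfold_locales (auto elim!: Q_arrE simp: fexp_value_boundary)
qed

lemma restricts_to_identity_proj: "restricts_to_identity B proj"
  by (simp add: restricts_to_identity_def)

text \<open>Induction on representatives: 2-cells are fixed by hypothesis, horizontal identities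
  because \<open>F\<close> commutes with \<open>ifun\<close> and fixes vertical morphisms, and
  composites by strictness.\<close>

lemma proj_unique:
  assumes "strict_double_functor Q C F" and "restricts_to_identity B F"
  shows "double_functor_eq Q F proj"
proof -
  interpret F: strict_double_functor Q C F by fact
  have "far (snd F) (fclass B \<Phi>) = val \<Phi>" if "formal_square B \<Phi>" for \<Phi>
    using that
  proof (induction \<Phi>)
    case (FCell \<phi>)
    then show ?case using assms(2) by (simp add: restricts_to_identity_def)
  next
    case (FId f)
    then show ?case using F.pres_i_arr[of f] assms(2) by (simp add: restricts_to_identity_def)
  next
    case (FV \<Psi> \<Phi>)
    then show ?case using F.F1.far_comp[of "fclass B \<Phi>" "fclass B \<Psi>"] by simp
  next
    case (FH \<Psi> \<Phi>)
    then show ?case using F.pres_comp_arr[of "fclass B \<Psi>" "fclass B \<Phi>"] by simp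
  qed
  then show ?thesis
    using assms(2)
    by (auto simp: double_functor_eq_def functor_eq_def restricts_to_identity_def elim!: Q_arrE)
qed

section \<open>Surjectivity on squares\<close>

lemma glob_gen_square_value:
  "\<Phi> \<in> glob_gen_squares C \<Longrightarrow> \<exists>\<Theta>. formal_square B \<Theta> \<and> val \<Theta> = \<Phi>"
proof (induction rule: glob_gen_squares.induct)
  case (globular \<Phi>)
  then show ?case by (auto intro!: exI[of _ "FCell \<Phi>"])
next
  case (hor_id f)
  then show ?case by (auto intro!: exI[of _ "FId f"])
next
  case (vcomp \<Phi> \<Psi>)
  then obtain \<Theta> \<Xi> where "formal_square B \<Theta>" "val \<Theta> = \<Phi>" "formal_square B \<Xi>" "val \<Xi> = \<Psi>" by blast
  with vcomp.hyps show ?case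
    \<comment> \<open>The witness is a formal square because the boundaries of values, which match
      in \<open>C\<close>, are the formal boundaries.\<close>
    by (intro exI[of _ "FV \<Xi> \<Theta>"]) (auto simp: fexp_value_boundary)
next
  case (hcomp \<Phi> \<Psi>)
  then obtain \<Theta> \<Xi> where "formal_square B \<Theta>" "val \<Theta> = \<Phi>" "formal_square B \<Xi>" "val \<Xi> = \<Psi>" by blast
  with hcomp.hyps show ?case
    by (intro exI[of _ "FH \<Xi> \<Theta>"]) (auto simp: fexp_value_boundary)
qed

lemma surjective_proj:
  assumes "globularly_generated C"
  shows "surjective_on_squares Q C proj"
proof -
  have "\<Phi> \<in> far (snd proj) ` Arr (C1 Q)" if "\<Phi> \<in> Arr (C1 C)" for \<Phi>
  proof -
    obtain \<Theta> where "formal_square B \<Theta>" "val \<Theta> = \<Phi>"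
      using assms \<open>\<Phi> \<in> Arr (C1 C)\<close> glob_gen_square_value unfolding globularly_generated_def by blast
    then show ?thesis
      by (intro image_eqI[of _ _ "fclass B \<Theta>"]) simp_all
  qed
  then show ?thesis
    by (auto simp: surjective_on_squares_def fexp_value_boundary elim!: Q_arrE)
qed

end

theorem theorem2p1:
  fixes B :: "('o, 'v, 'h, 't) dec_bicat"
    and C :: "('o, 'v, 'h, 't) dblcat"
  assumes "decorated_bicategory B"
    and "double_category C"
    and "globularly_generated C"
    and "dec_bicat_eq (Hstar C) B"
  shows "\<exists>\<pi>. strict_double_functor (freeQ B) C \<pi> \<and> restricts_to_identity B \<pi> \<and>
           (\<forall>\<pi>'. strict_double_functor (freeQ B) C \<pi>' \<and> restricts_to_identity B \<pi>'
              \<longrightarrow> double_functor_eq (freeQ B) \<pi>' \<pi>) \<and>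
           surjective_on_squares (freeQ B) C \<pi>"
proof -
  interpret free_double_over B C
    using assms by (intro free_double_over.intro free_double.intro free_double_over_axioms.intro)
  show ?thesis
    using strict_double_functor_proj restricts_to_identity_proj proj_unique surjective_proj assms(3)
    by blast
qed

end
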